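(* There is a compact connected $F$-space $K$ such that the vector lattice $C(K)$ of continuous real-valued functions on $K$ has a maximal (with respect to inclusion) $d$-independent system that is not a $d$-basis.
   Context: Compact spaces are assumed Hausdorff. A compact space is an $F$-space if disjoint cozero sets (equivalently, disjoint open $F_\sigma$-sets) have disjoint closures. In a vector lattice $X$, $x\perp y$ means $|x|\wedge|y|=0$, and $x\perp B$ means $x\perp b$ for all $b\in B$. A $d$-independent system in a vector lattice $X$ is a subset $D$ of $X$ such that for every band $B$ in $X$, every finite subset $F$ of $D$ and every choice $\{c_d:d\in F\}$ of non-zero scalars, the condition $\sum_{d\in F}c_d d\perp B$ implies $d\perp B$ for all $d\in F$. A $d$-independent system $D$ is a $d$-basis if for every $x\in X$ there are a full system $\mathcal{B}$ of pairwise disjoint bands in $X$ and a subset $\{y_B:B\in\mathcal{B}\}$ of $X$ such that for each $B\in\mathcal{B}$ the element $y_B$ is a linear combination of members of $D$ and $x-y_B\perp B$. Here a system $\mathcal{B}$ of bands is full if the only element of $X$ disjoint from every $B\in\mathcal{B}$ is $0$. *)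

theory Defs
  imports "HOL-Analysis.Analysis" "HOL-Library.Function_Algebras"
begin

section \<open>Vector lattices\<close>

text \<open>
  A type of classes \<^class>\<open>ordered_real_vector\<close> and \<^class>\<open>lattice\<close> is a vector lattice.  The vector
  lattices \<open>X\<close> below are vector sublattices of such a type, so that a type need not be
  introduced for each of them.  Bands, suprema and full systems are relative to \<open>X\<close>.
\<close>

definition vector_sublattice :: "'v::{ordered_real_vector, lattice} set \<Rightarrow> bool" where
  "vector_sublattice X \<longleftrightarrow> subspace X \<and> (\<forall>x\<in>X. \<forall>y\<in>X. inf x y \<in> X \<and> sup x y \<in> X)"

definition vl_abs :: "'v::{ordered_real_vector, lattice} \<Rightarrow> 'v" where
  "vl_abs x = sup x (- x)"

definition vl_disjoint :: "'v::{ordered_real_vector, lattice} \<Rightarrow> 'v \<Rightarrow> bool" where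
  "vl_disjoint x y \<longleftrightarrow> inf (vl_abs x) (vl_abs y) = 0"

definition vl_disjoint_set :: "'v::{ordered_real_vector, lattice} \<Rightarrow> 'v set \<Rightarrow> bool" where
  "vl_disjoint_set x B \<longleftrightarrow> (\<forall>b\<in>B. vl_disjoint x b)"

definition is_sup_in :: "'v::{ordered_real_vector, lattice} set \<Rightarrow> 'v set \<Rightarrow> 'v \<Rightarrow> bool" where
  "is_sup_in X A s \<longleftrightarrow>
     s \<in> X \<and> (\<forall>a\<in>A. a \<le> s) \<and> (\<forall>u\<in>X. (\<forall>a\<in>A. a \<le> u) \<longrightarrow> s \<le> u)"

text \<open>A band is an order closed ideal.\<close>

definition ideal_in :: "'v::{ordered_real_vector, lattice} set \<Rightarrow> 'v set \<Rightarrow> bool" where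
  "ideal_in X B \<longleftrightarrow>
     B \<subseteq> X \<and> subspace B \<and> (\<forall>x\<in>X. \<forall>y\<in>B. vl_abs x \<le> vl_abs y \<longrightarrow> x \<in> B)"

definition band_in :: "'v::{ordered_real_vector, lattice} set \<Rightarrow> 'v set \<Rightarrow> bool" where
  "band_in X B \<longleftrightarrow> ideal_in X B \<and> (\<forall>A s. A \<subseteq> B \<and> is_sup_in X A s \<longrightarrow> s \<in> B)"

definition full_system :: "'v::{ordered_real_vector, lattice} set \<Rightarrow> 'v set set \<Rightarrow> bool" where
  "full_system X \<B> \<longleftrightarrow> (\<forall>x\<in>X. (\<forall>B\<in>\<B>. vl_disjoint_set x B) \<longrightarrow> x = 0)"

definition pairwise_disjoint_bands :: "'v::{ordered_real_vector, lattice} set \<Rightarrow> 'v set set \<Rightarrow> bool" where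
  "pairwise_disjoint_bands X \<B> \<longleftrightarrow>
     (\<forall>B\<in>\<B>. band_in X B) \<and>
     (\<forall>B\<in>\<B>. \<forall>C\<in>\<B>. B \<noteq> C \<longrightarrow> (\<forall>b\<in>B. vl_disjoint_set b C))"


section \<open>\<open>d\<close>-independence and \<open>d\<close>-bases\<close>

definition d_independent :: "'v::{ordered_real_vector, lattice} set \<Rightarrow> 'v set \<Rightarrow> bool" where
  "d_independent X D \<longleftrightarrow>
     D \<subseteq> X \<and>
     (\<forall>B F c. band_in X B \<and> finite F \<and> F \<subseteq> D \<and> (\<forall>d\<in>F. c d \<noteq> 0) \<and>
        vl_disjoint_set (\<Sum>d\<in>F. (c d :: real) *\<^sub>R d) B
        \<longrightarrow> (\<forall>d\<in>F. vl_disjoint_set d B))"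

definition maximal_d_independent :: "'v::{ordered_real_vector, lattice} set \<Rightarrow> 'v set \<Rightarrow> bool" where
  "maximal_d_independent X D \<longleftrightarrow>
     d_independent X D \<and> (\<forall>E. d_independent X E \<and> D \<subseteq> E \<longrightarrow> E = D)"

definition d_basis :: "'v::{ordered_real_vector, lattice} set \<Rightarrow> 'v set \<Rightarrow> bool" where
  "d_basis X D \<longleftrightarrow>
     d_independent X D \<and>
     (\<forall>x\<in>X. \<exists>\<B> y. pairwise_disjoint_bands X \<B> \<and> full_system X \<B> \<and>
        (\<forall>B\<in>\<B>. y B \<in> span D \<and> vl_disjoint_set (x - y B) B))"


section \<open>The vector lattice \<open>C(K)\<close>\<close>

instantiation "fun" :: (type, real_vector) real_vector
begin

definition scaleR_fun :: "real \<Rightarrow> ('a \<Rightarrow> 'b) \<Rightarrow> 'a \<Rightarrow> 'b" where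
  "scaleR_fun r f = (\<lambda>p. r *\<^sub>R f p)"

instance
  by standard (simp_all add: scaleR_fun_def fun_eq_iff algebra_simps)

end

lemma scaleR_fun_apply [simp]: "(r *\<^sub>R f) p = r *\<^sub>R f p"
  by (simp add: scaleR_fun_def)

instance "fun" :: (type, ordered_real_vector) ordered_real_vector
  by standard (simp_all add: le_fun_def scaleR_left_mono scaleR_right_mono)

text \<open>
  HOL functions are total, so a function on \<open>K\<close> is represented by its extension by \<open>0\<close> to the
  whole type: this makes equality, order and lattice operations those of functions on \<open>K\<close>.
\<close>

definition continuous_functions :: "'a topology \<Rightarrow> ('a \<Rightarrow> real) set" where
  "continuous_functions K =
     {f. continuous_map K euclideanreal f \<and> (\<forall>p. p \<notin> topspace K \<longrightarrow> f p = 0)}"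

lemma vector_sublattice_continuous_functions: "vector_sublattice (continuous_functions K)"
  unfolding vector_sublattice_def subspace_def continuous_functions_def
  by (auto simp: plus_fun_def zero_fun_def scaleR_fun_def inf_fun_def sup_fun_def inf_min sup_max
      intro!: continuous_intros continuous_map_real_mult_left continuous_map_real_min continuous_map_real_max)


section \<open>\<open>F\<close>-spaces\<close>

definition cozero_set :: "'a topology \<Rightarrow> 'a set \<Rightarrow> bool" where
  "cozero_set K U \<longleftrightarrow>
     (\<exists>f. continuous_map K euclideanreal f \<and> U = {p \<in> topspace K. f p \<noteq> 0})"

definition compact_F_space :: "'a topology \<Rightarrow> bool" where
  "compact_F_space K \<longleftrightarrow>
     compact_space K \<and> Hausdorff_space K \<and>
     (\<forall>U V. cozero_set K U \<and> cozero_set K V \<and> U \<inter> V = {}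
        \<longrightarrow> K closure_of U \<inter> K closure_of V = {})"

text \<open>
  HOL cannot quantify over types inside a formula, so a statement "there is a compact space \<open>K\<close>"
  has to name a type of points.  The type \<^typ>\<open>(real \<Rightarrow> real) \<Rightarrow> real\<close> has \<open>2^2^c\<close> elements, where
  \<open>c\<close> is the cardinality of the continuum, and every compact Hausdorff space of weight at most
  \<open>2^c\<close> is homeomorphic to a subspace of that power of the real line.
\<close>

end

theory Submission
  imports Defs
begin

text \<open>
  In a connected compact \<open>F\<close>-space \<open>K\<close> a non-constant function \<open>f\<close> takes each value \<open>c\<close> strictly
  between its extreme values on a non-empty open set, because the open sets \<open>f < c\<close> and \<open>f > c\<close> have
  disjoint closures, which cannot cover \<open>K\<close>.  Hence \<open>{0, 1}\<close> is a maximal \<open>d\<close>-independent system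
  for every such \<open>K\<close>.  It is not a \<open>d\<close>-basis as soon as some \<open>x\<close> in \<open>C(K)\<close> is not constant on
  any non-empty open subset of some non-empty open set \<open>W\<close>.

  Such a \<open>K\<close> is found inside the Stone-Cech remainder of the plane, all of whose closed subsets are
  \<open>F\<close>-spaces.  The comb \<open>[0,\<infinity>) \<times> {0} \<union> \<nat> \<times> [0,1]\<close> has a connected trace on the remainder, and \<open>x\<close> is
  a function constant on each tooth whose values on the tips of the teeth at infinity fill \<open>[0,1]\<close>.
  Let \<open>K\<close> be minimal among the closed connected subsets of this trace that contain the trace of the
  base line and on whose tips \<open>x\<close> still takes all values in \<open>[0,1]\<close>.  If \<open>x\<close> were constant on an
  open subset of \<open>K\<close> off the base line, that subset could be removed.
\<close>

section \<open>The system consisting of \<open>0\<close> and \<open>1\<close>\<close>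

lemma vl_disjoint_fun_iff:
  fixes f g :: "'a \<Rightarrow> real"
  shows "vl_disjoint f g \<longleftrightarrow> (\<forall>p. f p = 0 \<or> g p = 0)"
proof -
  have "vl_disjoint f g \<longleftrightarrow> (\<forall>p. min \<bar>f p\<bar> \<bar>g p\<bar> = 0)"
    by (simp add: vl_disjoint_def vl_abs_def fun_eq_iff inf_min sup_max abs_real_def max_def
        cong: if_cong) (smt (verit))
  then show ?thesis
    by (auto simp: min_def) (metis abs_ge_zero abs_eq_0 order_antisym)+
qed

lemma restrict_in_continuous_functions:
  assumes "continuous_map K euclideanreal f"
  shows "(\<lambda>p. if p \<in> topspace K then f p else 0) \<in> continuous_functions K"
  using assms by (auto simp: continuous_functions_def intro: continuous_map_eq)

lemma indicator_in_continuous_functions: "indicat_real (topspace K) \<in> continuous_functions K"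
  using restrict_in_continuous_functions [of K "\<lambda>_. 1"]
  by (simp add: indicator_def [abs_def] of_bool_def)

lemma subspace_continuous_functions: "subspace (continuous_functions K)"
  using vector_sublattice_continuous_functions unfolding vector_sublattice_def by blast

lemma bump_function:
  assumes "compact_space K" "Hausdorff_space K" "closedin K S" "p \<in> topspace K - S"
  obtains b where "b \<in> continuous_functions K" "b p = 1" "\<And>q. q \<in> S \<Longrightarrow> b q = 0"
proof -
  have "completely_regular_space K"
    using assms by (simp add: completely_regular_eq_regular_space
        compact_Hausdorff_imp_regular_space compact_imp_locally_compact_space)
  then obtain f :: "'a \<Rightarrow> real" where f: "continuous_map K (top_of_set {0..1}) f" "f p = 0" "f ` S \<subseteq> {1}"
    using assms(3,4) unfolding completely_regular_space_def by blast
  define b where "b = (\<lambda>q. if q \<in> topspace K then 1 - f q else 0)"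
  have "continuous_map K euclideanreal (\<lambda>q. 1 - f q)"
    using f(1) by (auto simp: continuous_map_in_subtopology intro!: continuous_intros)
  then have "b \<in> continuous_functions K"
    unfolding b_def by (rule restrict_in_continuous_functions)
  moreover have "b p = 1" using assms(4) f(2) by (simp add: b_def)
  moreover have "b q = 0" if "q \<in> S" for q using f(3) that by (auto simp: b_def)
  ultimately show ?thesis using that by blast
qed

text \<open>A supremum \<open>s\<close> of functions that vanish wherever \<open>g\<close> does not
  must vanish there as well: otherwise subtracting \<open>min (max (s q) 0) \<bar>g q\<bar>\<close>
  at every \<open>q\<close> gives an upper bound that is smaller somewhere.\<close>

lemma band_in_disjoint_complement:
  assumes g: "g \<in> continuous_functions K"
  shows "band_in (continuous_functions K) {b \<in> continuous_functions K. vl_disjoint b g}"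
    (is "band_in ?X ?B")
proof -
  have "subspace ?B"
    using subspace_continuous_functions[of K]
    unfolding subspace_def vl_disjoint_fun_iff
    by (simp add: plus_fun_apply zero_fun_apply) (metis add.right_neutral)
  moreover have "x \<in> ?B" if "x \<in> ?X" "y \<in> ?B" "vl_abs x \<le> vl_abs y" for x y
  proof -
    have "\<bar>x p\<bar> \<le> \<bar>y p\<bar>" for p
      using that(3) by (auto simp: vl_abs_def le_fun_def sup_max abs_real_def dest: spec [of _ p])
    then have "x p = 0" if "y p = 0" for p
      by (metis that abs_le_zero_iff abs_zero)
    with \<open>x \<in> ?X\<close> \<open>y \<in> ?B\<close> show ?thesis by (auto simp: vl_disjoint_fun_iff)
  qed
  ultimately have "ideal_in ?X ?B" by (auto simp: ideal_in_def)
  moreover have "s \<in> ?B" if A: "A \<subseteq> ?B" and s: "is_sup_in ?X A s" for A s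
  proof -
    have sX: "s \<in> ?X" and ub: "\<And>a p. a \<in> A \<Longrightarrow> a p \<le> s p"
      and least: "\<And>u p. u \<in> ?X \<Longrightarrow> (\<And>a. a \<in> A \<Longrightarrow> a \<le> u) \<Longrightarrow> s p \<le> u p"
      using s by (auto simp: is_sup_in_def le_fun_def)
    note cont = sX [unfolded continuous_functions_def] g [unfolded continuous_functions_def]
    have "s p = 0" if gp: "g p \<noteq> 0" for p
    proof (rule ccontr)
      assume sp: "s p \<noteq> 0"
      have p: "p \<in> topspace K" using gp g by (auto simp: continuous_functions_def)
      \<comment> \<open>A supremum of the empty set would be a least element of the lattice, but
        subtracting the unit makes \<open>s\<close> smaller at \<open>p\<close>.\<close>
      have "A \<noteq> {}"
      proof
        assume "A = {}"
        have "s - indicat_real (topspace K) \<in> ?X"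
          using sX indicator_in_continuous_functions subspace_continuous_functions
          by (metis subspace_diff)
        from least [OF this, of p] \<open>A = {}\<close> p show False by simp
      qed
      then have s_nonneg: "s q \<ge> 0" if "g q \<noteq> 0" for q
      proof -
        obtain a where "a \<in> A" using \<open>A \<noteq> {}\<close> by blast
        then have "a q = 0" using A that by (auto simp: vl_disjoint_fun_iff)
        then show ?thesis using ub [OF \<open>a \<in> A\<close>, of q] by simp
      qed
      \<comment> \<open>an upper bound of \<^term>\<open>A\<close> that is too small at \<^term>\<open>p\<close>\<close>
      let ?u = "\<lambda>q. s q - min (max (s q) 0) \<bar>g q\<bar>"
      have "?u \<in> ?X"
        using cont by (auto simp: continuous_functions_def
            intro!: continuous_intros continuous_map_real_min continuous_map_real_max continuous_map_real_abs)
      moreover have "a \<le> ?u" if "a \<in> A" for a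
      proof (rule le_funI)
        fix q
        show "a q \<le> ?u q"
        proof (cases "g q = 0")
          case True
          then show ?thesis using ub [OF that, of q] by (simp add: min_def)
        next
          case False
          then have "a q = 0" using A that by (auto simp: vl_disjoint_fun_iff)
          then show ?thesis using s_nonneg [OF False] by simp
        qed
      qed
      ultimately have "s p \<le> ?u p" by (rule least)
      then show False using s_nonneg [OF gp] sp gp by (auto simp: min_def max_def split: if_splits)
    qed
    with sX show ?thesis by (auto simp: vl_disjoint_fun_iff)
  qed
  ultimately show ?thesis unfolding band_in_def by blast
qed

text \<open>The function \<open>b\<close> encodes a non-empty open set on which \<open>f\<close>
  equals \<open>c\<close>. Since \<open>c\<close> is going to be a coefficient of a linear
  combination, it is chosen non-zero. For non-constant \<open>f\<close>, \<open>b\<close> is a bump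
  off the closures of \<open>f < c\<close> and \<open>f > c\<close>.\<close>

lemma F_space_locally_constant_somewhere:
  assumes F: "compact_F_space K" and conn: "connected_space K"
    and f: "f \<in> continuous_functions K" "f \<noteq> 0"
  obtains c b where "c \<noteq> 0" "b \<in> continuous_functions K" "b \<noteq> 0" "\<And>p. b p \<noteq> 0 \<Longrightarrow> f p = c"
proof -
  have cf: "continuous_map K euclideanreal f" and f0: "\<And>p. p \<notin> topspace K \<Longrightarrow> f p = 0"
    using f by (auto simp: continuous_functions_def)
  obtain p0 where p0: "f p0 \<noteq> 0" using f(2) by (auto simp: fun_eq_iff)
  then have p0K: "p0 \<in> topspace K" using f0 by blast
  show ?thesis
  proof (cases "\<forall>p\<in>topspace K. f p = f p0")
    case True
    have "indicat_real (topspace K) p0 \<noteq> 0" using p0K by simp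
    then have "indicat_real (topspace K) \<noteq> 0" by (auto simp: fun_eq_iff)
    with that [OF p0 indicator_in_continuous_functions] True show ?thesis
      by (auto simp: indicator_def split: if_splits)
  next
    case False
    then obtain p1 where p1: "p1 \<in> topspace K" "f p1 \<noteq> f p0" by blast
    define m where "m = min (f p0) (f p1)"
    define M where "M = max (f p0) (f p1)"
    have "m < M" using p1 by (auto simp: m_def M_def)
    then obtain c where c: "m < c" "c < M" "c \<noteq> 0"
      by (metis dense less_trans order_less_irrefl)
    let ?U = "{p \<in> topspace K. f p < c}" and ?V = "{p \<in> topspace K. f p > c}"
    have "cozero_set K ?U" unfolding cozero_set_def
      by (rule exI [of _ "\<lambda>p. min (f p - c) 0"])
        (use cf in \<open>auto intro!: continuous_intros continuous_map_real_min simp: less_le min_less_iff_conj\<close>)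
    moreover have "cozero_set K ?V" unfolding cozero_set_def
      by (rule exI [of _ "\<lambda>p. max (f p - c) 0"])
        (use cf in \<open>auto intro!: continuous_intros continuous_map_real_max simp: less_le\<close>)
    moreover have "?U \<inter> ?V = {}" by auto
    ultimately have disj: "K closure_of ?U \<inter> K closure_of ?V = {}"
      using F by (auto simp: compact_F_space_def)
    have ne: "?U \<noteq> {}" "?V \<noteq> {}"
      using c p0K p1 by (force simp: m_def M_def min_def max_def split: if_splits)+
    have sub: "?U \<subseteq> K closure_of ?U" "?V \<subseteq> K closure_of ?V"
      by (auto intro!: closure_of_subset)
    have ne_top: "K closure_of ?U \<union> K closure_of ?V \<noteq> topspace K"
      using conn disj ne sub unfolding connected_space_closedin_eq
      by (metis (no_types, lifting) closedin_closure_of subset_empty)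
    define S where "S = K closure_of ?U \<union> K closure_of ?V"
    have S: "closedin K S" unfolding S_def by (intro closedin_Un closedin_closure_of)
    have "S \<subseteq> topspace K" "S \<noteq> topspace K"
      using ne_top S closedin_subset by (auto simp: S_def)
    then obtain p where p: "p \<in> topspace K - S" by blast
    have "compact_space K" "Hausdorff_space K" using F by (auto simp: compact_F_space_def)
    then obtain b where b: "b \<in> continuous_functions K" "b p = 1" "\<And>q. q \<in> S \<Longrightarrow> b q = 0"
      using bump_function [OF _ _ S p] by metis
    have fc: "f q = c" if "b q \<noteq> 0" for q
    proof -
      have "q \<in> topspace K" using b(1) that by (auto simp: continuous_functions_def)
      moreover have "q \<notin> ?U" "q \<notin> ?V" using b(3) [of q] that sub by (auto simp: S_def)
      ultimately show ?thesis by auto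
    qed
    have "b \<noteq> 0" using b(2) by (metis zero_fun_apply zero_neq_one)
    then show ?thesis using that [OF c(3) b(1)] fc by blast
  qed
qed

text \<open>The vector \<open>0\<close> is disjoint from everything and adds nothing to a sum, so it
  may be adjoined to any \<open>d\<close>-independent system; a maximal one has to contain
  it.\<close>

lemma d_independent_zero_one:
  shows "d_independent (continuous_functions K) {0, indicat_real (topspace K)}"
  unfolding d_independent_def
proof (intro conjI allI impI ballI)
  let ?e = "indicat_real (topspace K)"
  show "{0, ?e} \<subseteq> continuous_functions K"
    using indicator_in_continuous_functions subspace_continuous_functions
    by (auto intro: subspace_0)
  fix B F and c :: "_ \<Rightarrow> real" and d
  assume H: "band_in (continuous_functions K) B \<and> finite F \<and> F \<subseteq> {0, ?e} \<and> (\<forall>d\<in>F. c d \<noteq> 0) \<and>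
        vl_disjoint_set (\<Sum>d\<in>F. c d *\<^sub>R d) B" and d: "d \<in> F"
  show "vl_disjoint_set d B"
  proof (cases "d = 0")
    case True then show ?thesis by (simp add: vl_disjoint_set_def vl_disjoint_fun_iff)
  next
    case False
    then have e: "d = ?e" using d H by blast
    have "(\<Sum>x\<in>F. c x *\<^sub>R x) = (\<Sum>x\<in>{d}. c x *\<^sub>R x)"
      by (rule sum.mono_neutral_right) (use H d e in auto)
    then have "vl_disjoint_set (c d *\<^sub>R d) B" using H by simp
    moreover have "c d \<noteq> 0" using H d by blast
    ultimately show ?thesis by (auto simp: vl_disjoint_set_def vl_disjoint_fun_iff)
  qed
qed

text \<open>Suppose \<open>f\<close> is a further member, equal to \<open>c\<close> where
  \<open>b\<close> is non-zero, and let \<open>g\<close> be \<open>f\<close> minus \<open>c\<close>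
  times the unit. The band of functions disjoint from \<open>g\<close> contains \<open>b\<close>. As
  \<open>g\<close> is a combination of \<open>f\<close> and the unit with non-zero coefficients,
  independence would make the unit disjoint from \<open>b\<close>.\<close>

lemma maximal_d_independent_zero_one:
  assumes F: "compact_F_space K" and conn: "connected_space K"
  shows "maximal_d_independent (continuous_functions K) {0, indicat_real (topspace K)}"
  unfolding maximal_d_independent_def
proof (intro conjI allI impI)
  let ?e = "indicat_real (topspace K)" and ?X = "continuous_functions K"
  show "d_independent ?X {0, ?e}" by (rule d_independent_zero_one)
  fix E assume E: "d_independent ?X E \<and> {0, ?e} \<subseteq> E"
  have "f \<in> {0, ?e}" if "f \<in> E" for f
  proof (rule ccontr)
    assume nf: "f \<notin> {0, ?e}"
    have fX: "f \<in> ?X" using E that by (auto simp: d_independent_def)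
    obtain c b where cb: "c \<noteq> 0" "b \<in> ?X" "b \<noteq> 0" "\<And>p. b p \<noteq> 0 \<Longrightarrow> f p = c"
      using F_space_locally_constant_somewhere [OF F conn fX] nf by auto
    define g where "g = f - c *\<^sub>R ?e"
    define B where "B = {b \<in> ?X. vl_disjoint b g}"
    have "g \<in> ?X"
      unfolding g_def using fX indicator_in_continuous_functions subspace_continuous_functions
      by (metis subspace_diff subspace_scale)
    then have band: "band_in ?X B" unfolding B_def by (rule band_in_disjoint_complement)
    define k where "k = (\<lambda>d. if d = f then 1 else - c)"
    have "(\<Sum>d\<in>{f, ?e}. k d *\<^sub>R d) = g"
      using nf by (auto simp: g_def k_def fun_eq_iff)
    moreover have "vl_disjoint_set g B" by (auto simp: B_def vl_disjoint_set_def vl_disjoint_fun_iff)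
    ultimately have "vl_disjoint_set (\<Sum>d\<in>{f, ?e}. k d *\<^sub>R d) B" by simp
    moreover have "\<forall>d\<in>{f, ?e}. k d \<noteq> 0" using cb(1) by (simp add: k_def)
    moreover have "finite {f, ?e}" "{f, ?e} \<subseteq> E" using E that by auto
    ultimately have "\<forall>d\<in>{f, ?e}. vl_disjoint_set d B"
      using E band unfolding d_independent_def by blast
    then have "vl_disjoint_set ?e B" by blast
    moreover have "b \<in> B"
      using cb(2,4) by (auto simp: B_def vl_disjoint_fun_iff g_def continuous_functions_def indicator_def)
    ultimately have "\<forall>p. ?e p = 0 \<or> b p = 0" by (auto simp: vl_disjoint_set_def vl_disjoint_fun_iff)
    then have "b p = 0" for p using cb(2)
      by (cases "p \<in> topspace K") (auto simp: continuous_functions_def indicator_def split: if_splits)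
    then show False using cb(3) by (auto simp: fun_eq_iff)
  qed
  with E show "E = {0, ?e}" by blast
qed

text \<open>The span of the system consists of the multiples of the unit, so a
  \<open>d\<close>-basis would make \<open>x\<close> constant wherever a given member
  \<open>b\<close> of a band is non-zero. Fullness, tested on a bump \<open>w\<close> supported in
  \<open>W\<close>, supplies a \<open>b\<close> whose non-zero set meets \<open>W\<close>.\<close>

lemma not_d_basis_zero_one:
  assumes K: "compact_space K" "Hausdorff_space K"
    and x: "continuous_map K euclideanreal x"
    and W: "openin K W" "W \<noteq> {}"
    and nowhere: "\<And>G c. openin K G \<Longrightarrow> G \<subseteq> W \<Longrightarrow> G \<noteq> {} \<Longrightarrow> \<exists>p\<in>G. x p \<noteq> c"
  shows "\<not> d_basis (continuous_functions K) {0, indicat_real (topspace K)}"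
proof
  let ?e = "indicat_real (topspace K)" and ?X = "continuous_functions K"
  assume basis: "d_basis ?X {0, ?e}"
  define x' where "x' = (\<lambda>p. if p \<in> topspace K then x p else 0)"
  have "x' \<in> ?X" unfolding x'_def by (rule restrict_in_continuous_functions [OF x])
  then obtain \<B> y where full: "full_system ?X \<B>" and bands: "pairwise_disjoint_bands ?X \<B>"
    and y: "\<And>B. B \<in> \<B> \<Longrightarrow> y B \<in> span {0, ?e}" "\<And>B. B \<in> \<B> \<Longrightarrow> vl_disjoint_set (x' - y B) B"
    using basis unfolding d_basis_def by blast
  obtain p where p: "p \<in> W" using W by blast
  have "closedin K (topspace K - W)" "p \<in> topspace K - (topspace K - W)"
    using W p openin_subset by fastforce+
  then obtain w where w: "w \<in> ?X" "w p = 1" "\<And>q. q \<in> topspace K - W \<Longrightarrow> w q = 0"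
    using bump_function [OF K] by metis
  have "w \<noteq> 0" using w(2) by (metis zero_fun_apply zero_neq_one)
  then have "\<not> (\<forall>B\<in>\<B>. vl_disjoint_set w B)"
    using full w(1) by (auto simp: full_system_def)
  then obtain B b q where B: "B \<in> \<B>" "b \<in> B" and q: "w q \<noteq> 0" "b q \<noteq> 0"
    by (auto simp: vl_disjoint_set_def vl_disjoint_fun_iff)
  have bX: "b \<in> ?X"
    using bands B by (auto simp: pairwise_disjoint_bands_def band_in_def ideal_in_def)
  obtain c where c: "y B = c *\<^sub>R ?e"
    using y(1) [OF B(1)] by (auto simp: span_insert_0 span_singleton)
  let ?G = "{r \<in> topspace K. b r \<in> - {0}} \<inter> W"
  have "openin K {r \<in> topspace K. b r \<in> - {0}}"
    using bX by (intro openin_continuous_map_preimage) (auto simp: continuous_functions_def)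
  then have "openin K ?G" using W(1) by blast
  moreover have "q \<in> ?G"
    using q w(1,3) by (fastforce simp: continuous_functions_def)
  ultimately obtain r where r: "r \<in> ?G" "x r \<noteq> c" using nowhere [of ?G c] by blast
  have "(x' - y B) r = 0"
    using y(2) [OF B(1)] B(2) r(1) by (fastforce simp: vl_disjoint_set_def vl_disjoint_fun_iff)
  then show False using r by (simp add: x'_def c)
qed

section \<open>Chains of compact sets and powers of the real line\<close>

text \<open>Complements reverse inclusion and turn intersections into unions, which reduces the
  claim to the usual Zorn lemma.\<close>

lemma Zorn_minimal_set:
  assumes "\<A> \<noteq> {}" and "\<And>\<C>. \<C> \<noteq> {} \<Longrightarrow> subset.chain \<A> \<C> \<Longrightarrow> \<Inter>\<C> \<in> \<A>"
  shows "\<exists>M\<in>\<A>. \<forall>X\<in>\<A>. X \<subseteq> M \<longrightarrow> X = M"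
proof -
  have "\<exists>M\<in>uminus ` \<A>. \<forall>X\<in>uminus ` \<A>. M \<subseteq> X \<longrightarrow> X = M"
  proof (rule subset_Zorn_nonempty)
    show "uminus ` \<A> \<noteq> {}" using assms(1) by blast
    fix \<C> assume \<C>: "\<C> \<noteq> {}" "subset.chain (uminus ` \<A>) \<C>"
    then have "uminus ` \<C> \<subseteq> \<A>" "\<forall>X\<in>\<C>. \<forall>Y\<in>\<C>. X \<subseteq> Y \<or> Y \<subseteq> X"
      by (auto simp: subset_chain_def)
    then have "subset.chain \<A> (uminus ` \<C>)" by (auto simp: subset_chain_def)
    then have "\<Inter>(uminus ` \<C>) \<in> \<A>" using \<C>(1) by (intro assms(2)) auto
    moreover have "\<Union>\<C> = - \<Inter>(uminus ` \<C>)" by auto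
    ultimately show "\<Union>\<C> \<in> uminus ` \<A>" by blast
  qed
  then show ?thesis by auto
qed

lemma compact_chain_Inter_nonempty:
  fixes \<C> :: "'a::t2_space set set"
  assumes ne: "\<C> \<noteq> {}" and comp: "\<And>S. S \<in> \<C> \<Longrightarrow> compact S \<and> S \<noteq> {}"
    and chain: "\<And>S T. S \<in> \<C> \<Longrightarrow> T \<in> \<C> \<Longrightarrow> S \<subseteq> T \<or> T \<subseteq> S"
  shows "\<Inter>\<C> \<noteq> {}"
proof -
  obtain S where S: "S \<in> \<C>" using ne by blast
  have "S \<inter> \<Inter>\<C> \<noteq> {}"
  proof (rule compact_imp_fip)
    show "compact S" "\<And>T. T \<in> \<C> \<Longrightarrow> closed T" using comp S compact_imp_closed by blast+
    fix F assume F: "finite F" "F \<subseteq> \<C>"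
    \<comment> \<open>In a chain, a finite subfamily together with \<open>S\<close> has a smallest
      member, and that member is non-empty.\<close>
    have "\<exists>T\<in>\<C>. T \<subseteq> S \<inter> \<Inter>F" using F
    proof (induction F)
      case empty then show ?case using S by auto
    next
      case (insert X F)
      then obtain T where T: "T \<in> \<C>" "T \<subseteq> S \<inter> \<Inter>F" by auto
      have "X \<in> \<C>" using insert.prems by simp
      with T consider "T \<subseteq> X" | "X \<subseteq> T" using chain by blast
      then show ?case
      proof cases
        case 1
        then show ?thesis using \<open>T \<in> \<C>\<close> \<open>T \<subseteq> S \<inter> \<Inter>F\<close> by (intro bexI [of _ T]) auto
      next
        case 2
        then show ?thesis using \<open>X \<in> \<C>\<close> \<open>T \<subseteq> S \<inter> \<Inter>F\<close> by (intro bexI [of _ X]) auto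
      qed
    qed
    then show "S \<inter> \<Inter>F \<noteq> {}" using comp by fastforce
  qed
  then show ?thesis by blast
qed

lemma Hausdorff_space_euclidean_t2: "Hausdorff_space (euclidean :: 'a::t2_space topology)"
  by (auto simp: Hausdorff_space_def disjnt_def separation_t2)

text \<open>If the intersection split into \<open>A\<close> and \<open>B\<close>, enclose these in
  disjoint open \<open>U\<close> and \<open>V\<close>. Each member of the chain is connected and
  meets both, so it leaves \<open>U \<union> V\<close>. The parts left over form a chain of
  non-empty compact sets, and a common point of them contradicts the splitting.\<close>

lemma connected_chain_Inter:
  fixes \<C> :: "'a::t2_space set set"
  assumes ne: "\<C> \<noteq> {}" and comp: "\<And>S. S \<in> \<C> \<Longrightarrow> compact S \<and> connected S"
    and chain: "\<And>S T. S \<in> \<C> \<Longrightarrow> T \<in> \<C> \<Longrightarrow> S \<subseteq> T \<or> T \<subseteq> S"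
  shows "connected (\<Inter>\<C>)"
proof -
  have cl: "closed (\<Inter>\<C>)" using comp compact_imp_closed by blast
  obtain S0 where S0: "S0 \<in> \<C>" "compact S0" using ne comp by blast
  have False if AB: "closed A" "closed B" "A \<inter> B = {}" "A \<union> B = \<Inter>\<C>" "A \<noteq> {}" "B \<noteq> {}" for A B
  proof -
    have "A \<subseteq> S0" "B \<subseteq> S0" using AB(4) S0 by blast+
    then have "compact A" "compact B"
      using AB(1,2) S0(2) by (metis compact_Int_closed inf.absorb2)+
    then have "\<exists>U V. openin euclidean U \<and> openin euclidean V \<and> A \<subseteq> U \<and> B \<subseteq> V \<and> disjnt U V"
      using AB(3) Hausdorff_space_euclidean_t2 [where 'a='a]
      unfolding Hausdorff_space_compact_sets by (simp add: disjnt_def)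
    then obtain U V where UV: "open U" "open V" "A \<subseteq> U" "B \<subseteq> V" "U \<inter> V = {}"
      by (auto simp: disjnt_def)
    let ?\<D> = "(\<lambda>S. S - (U \<union> V)) ` \<C>"
    have "\<Inter>?\<D> \<noteq> {}"
    proof (rule compact_chain_Inter_nonempty)
      show "?\<D> \<noteq> {}" using ne by blast
      show "S \<subseteq> T \<or> T \<subseteq> S" if "S \<in> ?\<D>" "T \<in> ?\<D>" for S T
        using that chain by blast
      show "compact S \<and> S \<noteq> {}" if S: "S \<in> ?\<D>" for S
      proof -
        obtain X where X: "X \<in> \<C>" "S = X - (U \<union> V)" using S by blast
        have "A \<subseteq> X" "B \<subseteq> X" using X AB(4) by blast+
        then have "\<not> X \<subseteq> U \<union> V"
          using comp [OF X(1)] UV AB(5,6) connectedD [of X U V] by blast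
        then show ?thesis using X comp UV by (auto intro: compact_diff)
      qed
    qed
    then have "\<Inter>\<C> - (U \<union> V) \<noteq> {}" using ne by blast
    then show False using AB(4) UV by blast
  qed
  then show ?thesis unfolding connected_closed_set [OF cl] by blast
qed

section \<open>Separation and compactness in powers\<close>

lemma open_coordinate: "open S \<Longrightarrow> open {p :: 'i \<Rightarrow> 'a::topological_space. p i \<in> S}"
  using open_vimage [of S "\<lambda>p. p i"] by (simp add: vimage_def)

text \<open>Distinct functions differ in a coordinate, where the separation takes place. The aim is
  \<open>t2_space\<close>, for which the chain lemmas are stated; the weaker classes come first
  because \<open>t2_space\<close> is a subclass of them.\<close>

instance "fun" :: (type, t0_space) t0_space
proof
  fix f g :: "'a \<Rightarrow> 'b" assume "f \<noteq> g"
  then obtain i where i: "f i \<noteq> g i" by blast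
  obtain U where "open U" "\<not> (f i \<in> U \<longleftrightarrow> g i \<in> U)" using iffD1 [OF separation_t0 i] by (elim exE conjE)
  then show "\<exists>U. open U \<and> \<not> (f \<in> U \<longleftrightarrow> g \<in> U)"
    by (intro exI [of _ "{h. h i \<in> U}"]) (auto simp: open_coordinate)
qed

instance "fun" :: (type, t1_space) t1_space
proof
  fix f g :: "'a \<Rightarrow> 'b" assume "f \<noteq> g"
  then obtain i where i: "f i \<noteq> g i" by blast
  obtain U where "open U" "f i \<in> U" "g i \<notin> U" using i unfolding separation_t1 by blast
  then show "\<exists>U. open U \<and> f \<in> U \<and> g \<notin> U"
    by (intro exI [of _ "{h. h i \<in> U}"]) (auto simp: open_coordinate)
qed

instance "fun" :: (type, t2_space) t2_space
proof
  fix f g :: "'a \<Rightarrow> 'b" assume "f \<noteq> g"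
  then obtain i where i: "f i \<noteq> g i" by blast
  obtain U V where "open U" "open V" "f i \<in> U" "g i \<in> V" "U \<inter> V = {}"
    using i unfolding separation_t2 by blast
  then show "\<exists>U V. open U \<and> open V \<and> f \<in> U \<and> g \<in> V \<and> U \<inter> V = {}"
    by (intro exI [of _ "{h. h i \<in> U}"] exI [of _ "{h. h i \<in> V}"]) (auto simp: open_coordinate)
qed

lemma compact_cube: "compact {p :: 'i \<Rightarrow> real. \<forall>i. p i \<in> {0..1}}"
proof -
  have "{p :: 'i \<Rightarrow> real. \<forall>i. p i \<in> {0..1}} = PiE UNIV (\<lambda>_. {0..1})" by (auto simp: PiE_def)
  moreover have "compactin (product_topology (\<lambda>_. euclidean) (UNIV :: 'i set)) (PiE UNIV (\<lambda>_. {0..1::real}))"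
    by (simp add: compactin_PiE)
  ultimately show ?thesis by (simp add: euclidean_product_topology)
qed

lemma closed_coordinate: "closed S \<Longrightarrow> closed {p :: 'i \<Rightarrow> real. p i \<in> S}"
  using closed_vimage [of S "\<lambda>p. p i"] by (simp add: vimage_def)

section \<open>The remainder is an \<open>F\<close>-space\<close>

text \<open>
  Since \<^term>\<open>j\<close> has all continuous functions into \<open>[0,1]\<close> among its coordinates, the closure of its
  range is the Stone-Cech compactification of \<^typ>\<open>'x\<close>.
\<close>

locale cube_compactification =
  fixes j :: "'x::real_normed_vector \<Rightarrow> 'i \<Rightarrow> real"
  assumes cont_j: "continuous_on UNIV j"
    and j_range: "j z i \<in> {0..1}"
    and coordinate: "continuous_on UNIV h \<Longrightarrow> (\<And>z. h z \<in> {0..1}) \<Longrightarrow> \<exists>i. \<forall>z. j z i = h z"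
begin

text \<open>For the plane, whose closed balls are compact, this is the Stone-Cech compactification
  minus the image of the plane.\<close>

definition remainder :: "('i \<Rightarrow> real) set" where
  "remainder = (\<Inter>m::nat. closure (j ` {z. norm z \<ge> real m}))"

lemma closure_image_subset_cube: "closure (j ` S) \<subseteq> {p. \<forall>i. p i \<in> {0..1}}"
proof (rule closure_minimal)
  show "closed {p :: 'i \<Rightarrow> real. \<forall>i. p i \<in> {0..1}}" by (rule compact_imp_closed [OF compact_cube])
qed (use j_range in auto)

lemma compact_closure_image: "compact (closure (j ` S))"
  using compact_Int_closed [OF compact_cube closed_closure] closure_image_subset_cube
  by (metis inf.absorb2)

lemma closure_image_coordinate:
  assumes "p \<in> closure (j ` S)" "closed C" "\<And>z. z \<in> S \<Longrightarrow> j z i \<in> C"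
  shows "p i \<in> C"
proof -
  have "closure (j ` S) \<subseteq> {p. p i \<in> C}"
    using assms(2,3) by (intro closure_minimal closed_coordinate) auto
  with assms(1) show ?thesis by blast
qed

text \<open>Near \<open>p\<close> the function \<open>F\<close> exceeds \<open>e = F p / 2\<close>,
  so \<open>norm z * F (j z)\<close> is at least \<open>1/2\<close> once \<open>norm z\<close> is at
  least \<open>1 / (2 * e)\<close>. Such \<open>j z\<close> accumulate at \<open>p\<close>, and all
  of them have the value \<open>v\<close> in coordinate \<open>i\<close>.\<close>

lemma coordinate_eq_at_infinity:
  assumes F: "continuous_on C F" "closed C" "range j \<subseteq> C" and p: "p \<in> remainder" "p \<in> C" "F p > 0"
    and i: "\<And>z. norm z * F (j z) \<ge> 1/2 \<Longrightarrow> j z i = v"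
  shows "p i = v"
proof (rule ccontr)
  assume "p i \<noteq> v"
  define e where "e = F p / 2"
  have e: "0 < e" "e < F p" using p(3) by (auto simp: e_def)
  obtain T where T: "open T" "T \<inter> C = C \<inter> F -` {e<..}"
    using F(1) by (metis continuous_on_open_invariant open_greaterThan Int_commute)
  have "open (T \<inter> {q. q i \<in> - {v}})"
    using T(1) by (intro open_Int open_coordinate) auto
  moreover obtain m :: nat where m: "real m \<ge> 1 / (2 * e)" using real_arch_simple by blast
  moreover have "p \<in> (T \<inter> {q. q i \<in> - {v}}) \<inter> closure (j ` {z. norm z \<ge> real m})"
    using \<open>p i \<noteq> v\<close> T(2) p e by (auto simp: remainder_def)
  ultimately have "(T \<inter> {q. q i \<in> - {v}}) \<inter> j ` {z. norm z \<ge> real m} \<noteq> {}"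
    using open_Int_closure_eq_empty by blast
  then obtain z where z: "norm z \<ge> real m" "j z \<in> T" "j z i \<noteq> v" by auto
  have "F (j z) > e" using z(2) T(2) F(3) by blast
  moreover have "1 / (2 * e) * e \<le> norm z * F (j z)"
    using m z(1) \<open>F (j z) > e\<close> e by (intro mult_mono) auto
  ultimately show False using i [of z] z(3) e by auto
qed

text \<open>Tietze extends \<open>\<bar>u p\<bar> - \<bar>v p\<bar>\<close> from \<open>K\<close> to
  a function \<open>F\<close> on the whole compactification. A coordinate built from
  \<open>F\<close> is \<open>1\<close> on \<open>U\<close> and \<open>0\<close> on \<open>V\<close>,
  and the closures inherit these values.\<close>

lemma compact_F_space_remainder:
  assumes K: "closed K" "K \<subseteq> remainder"
  shows "compact_F_space (top_of_set K)"
proof -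
  define C where "C = closure (range j)"
  have C: "compact C" "closed C" "range j \<subseteq> C"
    unfolding C_def by (rule compact_closure_image closed_closure closure_subset)+
  have KC: "K \<subseteq> C"
    using K(2) closure_mono [of "j ` {z. norm z \<ge> real 0}" "range j"]
    unfolding remainder_def C_def by blast
  have haus: "Hausdorff_space (top_of_set S)" for S :: "('i \<Rightarrow> real) set"
    by (rule Hausdorff_space_subtopology) (rule Hausdorff_space_euclidean_t2)
  have compK: "compact K" using C(1) K(1) KC by (metis compact_Int_closed inf.absorb2)
  have cozero: "\<exists>u :: _ \<Rightarrow> real. continuous_on K u \<and> U = {p\<in>K. u p \<noteq> 0}" if "cozero_set (top_of_set K) U" for U
    using that by (simp add: cozero_set_def)
  have "top_of_set K closure_of U \<inter> top_of_set K closure_of V = {}"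
    if UV: "cozero_set (top_of_set K) U" "cozero_set (top_of_set K) V" "U \<inter> V = {}" for U V
  proof -
    obtain u v :: "_ \<Rightarrow> real" where u: "continuous_on K u" "U = {p\<in>K. u p \<noteq> 0}" and v: "continuous_on K v" "V = {p\<in>K. v p \<noteq> 0}"
      using cozero [OF UV(1)] cozero [OF UV(2)] by blast
    have norm_C: "normal_space (top_of_set C)"
      using C(1) haus by (intro compact_Hausdorff_or_regular_imp_normal_space) (auto simp: compact_space_subtopology)
    have K_C: "closedin (top_of_set C) K" using K(1) KC by (simp add: closed_subset)
    have cont_uv: "continuous_map (subtopology (top_of_set C) K) euclideanreal (\<lambda>p. \<bar>u p\<bar> - \<bar>v p\<bar>)"
      using u(1) v(1) KC by (auto simp: subtopology_subtopology inf.absorb2 intro!: continuous_intros)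
    obtain F where "continuous_map (top_of_set C) euclideanreal F" and F_eq: "\<And>p. p \<in> K \<Longrightarrow> F p = \<bar>u p\<bar> - \<bar>v p\<bar>"
      by (rule Tietze_extension_realinterval [OF norm_C K_C is_interval_univ _ cont_uv]) auto
    then have F: "continuous_on C F" by simp
    have "continuous_on UNIV (\<lambda>z. F (j z))"
      using continuous_on_compose2 [OF F cont_j] C(3) by auto
    then have "continuous_on UNIV (\<lambda>z. max 0 (min 1 (1/2 + norm z * F (j z))))"
      by (intro continuous_intros)
    \<comment> \<open>The factor \<^term>\<open>norm z\<close> makes this function equal to \<open>1\<close> near points at infinity where
      \<^term>\<open>F\<close> is positive, and to \<open>0\<close> near those where it is negative.\<close>
    from coordinate [OF this] obtain i where i: "\<And>z. j z i = max 0 (min 1 (1/2 + norm z * F (j z)))"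
      by auto
    have "p i = 1" if "p \<in> U" for p
    proof (rule coordinate_eq_at_infinity [OF F C(2,3)])
      have "v p = 0" using UV(3) that u v by blast
      then show "F p > 0" using that u F_eq by auto
      show "j z i = 1" if "norm z * F (j z) \<ge> 1/2" for z using that i by auto
    qed (use that u K KC in auto)
    then have U1: "U \<subseteq> {p \<in> K. p i \<in> {1}}" using u by blast
    have "p i = 0" if "p \<in> V" for p
    proof (rule coordinate_eq_at_infinity [OF _ C(2,3)])
      show "continuous_on C (\<lambda>p. - F p)" using F by (intro continuous_intros)
      have "u p = 0" using UV(3) that u v by blast
      then show "- F p > 0" using that v F_eq by auto
      show "j z i = 0" if "norm z * - F (j z) \<ge> 1/2" for z using that i by auto
    qed (use that v K KC in auto)
    then have V0: "V \<subseteq> {p \<in> K. p i \<in> {0}}" using v by blast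
    have clo: "closedin (top_of_set K) {p \<in> K. p i \<in> S}" if "closed S" for S
      using closedin_closed_Int [OF closed_coordinate [OF that]] by (simp add: Collect_conj_eq)
    have "top_of_set K closure_of U \<subseteq> {p \<in> K. p i \<in> {1}}" "top_of_set K closure_of V \<subseteq> {p \<in> K. p i \<in> {0}}"
      by (rule closure_of_minimal [OF U1 clo] closure_of_minimal [OF V0 clo], simp)+
    then show ?thesis by force
  qed
  then show ?thesis using haus compK by (auto simp: compact_F_space_def compact_space_subtopology)
qed

end

section \<open>The comb\<close>

text \<open>A bijection \<open>e\<close> between the plane and the line lets real functions serve as
  indices: \<open>g\<close> indexes \<open>g\<close> composed with \<open>e\<close>, clamped to
  \<open>[0,1]\<close>, when this composition is continuous, and the zero function
  otherwise.\<close>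

lemma exists_cube_compactification_plane:
  obtains j :: "real \<times> real \<Rightarrow> (real \<Rightarrow> real) \<Rightarrow> real" where "cube_compactification j"
proof -
  have "(card_of ((UNIV :: real set) \<times> (UNIV :: real set)), card_of (UNIV :: real set)) \<in> ordIso"
    by (rule card_of_Times_same_infinite) (rule infinite_UNIV_char_0)
  then obtain e :: "real \<times> real \<Rightarrow> real" where "bij_betw e (UNIV \<times> UNIV) UNIV"
    using card_of_ordIso by blast
  then have inj: "inj e" by (simp add: bij_betw_def)
  define j where "j z g = (if continuous_on UNIV (\<lambda>w. g (e w)) then max 0 (min 1 (g (e z))) else 0)"
    for z and g :: "real \<Rightarrow> real"
  have "cube_compactification j"
  proof
    have "continuous_on UNIV (\<lambda>z. j z g)" for g
      by (cases "continuous_on UNIV (\<lambda>w. g (e w))") (auto simp: j_def intro!: continuous_intros)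
    then show "continuous_on UNIV j" by (rule continuous_on_coordinatewise_then_product)
    show "j z g \<in> {0..1}" for z g by (auto simp: j_def)
    fix h :: "real \<times> real \<Rightarrow> real"
    assume h: "continuous_on UNIV h" "\<And>z. h z \<in> {0..1}"
    have "j z (\<lambda>r. h (inv e r)) = h z" for z
      using h(1) h(2) [of z] inj by (simp add: j_def)
    then show "\<exists>i. \<forall>z. j z i = h z" by blast
  qed
  then show ?thesis using that by blast
qed

text \<open>Gaps between consecutive square roots of integers tend to \<open>0\<close>. So for a
  large solution \<open>y\<close> of \<open>sin y = c\<close>, the root of the integer part of
  \<open>y\<^sup>2\<close> is within \<open>1 / y\<close> of \<open>y\<close>, and
  \<open>sin\<close> is 1-Lipschitz.\<close>

lemma sin_sqrt_dense:
  fixes c e :: real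
  assumes "\<bar>c\<bar> \<le> 1" "e > 0"
  obtains k where "k \<ge> n" "\<bar>sin (sqrt (real k)) - c\<bar> < e"
proof -
  obtain t where t: "sin t = c" "\<bar>t\<bar> \<le> pi"
    using arcsin [of c] assms(1) pi_gt_zero by (intro that [of "arcsin c"]) (auto simp: abs_le_iff)
  \<comment> \<open>The slack \<open>5\<close> absorbs \<open>t\<close>, which is above
    \<open>-4\<close>, and leaves room for both lower bounds on \<open>y\<close>.\<close>
  obtain m :: nat where m: "real m \<ge> real n + 1 / e + 5" using real_arch_simple by blast
  define y where "y = t + 2 * real m * pi"
  have "2 * real m * pi \<ge> 2 * real m * 1" using pi_gt3 by (intro mult_left_mono) auto
  moreover have "pi < 4" by (rule pi_less_4)
  ultimately have y: "y \<ge> real n + 1 / e" "y \<ge> real n + 1"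
    using t(2) m divide_pos_pos [OF zero_less_one assms(2)] unfolding y_def abs_le_iff
    by linarith+
  define k where "k = nat \<lfloor>y\<^sup>2\<rfloor>"
  have y_pos: "y > 0" using y(2) by linarith
  have k: "real k \<le> y\<^sup>2" "y\<^sup>2 < real k + 1" by (auto simp: k_def)
  have le: "sqrt (real k) \<le> y" using k(1) y_pos by (simp add: real_le_lsqrt)
  have "(y - sqrt (real k)) * y \<le> (y - sqrt (real k)) * (y + sqrt (real k))"
    using le by (intro mult_left_mono) auto
  also have "\<dots> = y\<^sup>2 - real k" by (simp add: algebra_simps power2_eq_square)
  also have "\<dots> < 1" using k(2) by simp
  finally have "y - sqrt (real k) < 1 / y" using y_pos by (simp add: field_simps)
  also have "1 / y \<le> e"
  proof -
    have "1 / e \<le> y" using y(1) by simp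
    then show ?thesis using y_pos assms(2) by (simp add: field_simps)
  qed
  finally have "\<bar>sqrt (real k) - y\<bar> < e" using le by simp
  moreover have lip: "\<bar>sin a - sin b\<bar> \<le> \<bar>a - b\<bar>" for a b :: real
  proof -
    have "\<bar>sin a - sin b\<bar> = 2 * \<bar>sin ((a - b) / 2)\<bar> * \<bar>cos ((a + b) / 2)\<bar>"
      by (simp add: sin_diff_sin abs_mult)
    also have "\<dots> \<le> 2 * \<bar>(a - b) / 2\<bar> * 1"
      by (intro mult_mono order_refl abs_sin_x_le_abs_x abs_cos_le_one) auto
    finally show ?thesis by simp
  qed
  moreover have "sin y = c"
    using t(1) by (simp add: y_def sin_add sin_2npi cos_2npi)
  moreover have "k \<ge> n"
  proof -
    have "real n * 1 \<le> y * y" using y(2) by (intro mult_mono) auto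
    then show ?thesis unfolding k_def by (simp add: le_nat_floor power2_eq_square)
  qed
  ultimately show ?thesis using that [of k] lip [of "sqrt (real k)" y] by simp
qed

text \<open>The set of teeth is a parameter because both tails \<open>{m..}\<close> and
  complementary subfamilies \<open>N\<close> and \<open>- N\<close> occur below.\<close>

definition teeth :: "nat set \<Rightarrow> (real \<times> real) set" where
  "teeth A = (real ` A) \<times> {0..1}"

definition halfline :: "nat \<Rightarrow> (real \<times> real) set" where
  "halfline m = {real m..} \<times> {0}"

lemma connected_comb: "connected (halfline m \<union> teeth {m..})"
proof -
  have "halfline m \<union> teeth {m..} = halfline m \<union> (\<Union>k\<in>{m..}. {real k} \<times> {0..1})"
    by (auto simp: teeth_def)
  moreover have "connected (halfline m \<union> (\<Union>k\<in>{m..}. {real k} \<times> {0..1::real}))"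
  proof (rule connected_Un_UN)
    show "connected (halfline m)" unfolding halfline_def by (intro connected_Times) auto
    show "connected X" if "X \<in> (\<lambda>k. {real k} \<times> {0..1::real}) ` {m..}" for X
      using that by (auto intro!: connected_Times)
    show "halfline m \<inter> X \<noteq> {}" if X: "X \<in> (\<lambda>k. {real k} \<times> {0..1::real}) ` {m..}" for X
    proof -
      obtain k where "k \<ge> m" "X = {real k} \<times> {0..1::real}" using X by blast
      then have "(real k, 0) \<in> halfline m \<inter> X" by (simp add: halfline_def)
      then show ?thesis by blast
    qed
  qed
  ultimately show ?thesis by simp
qed

section \<open>Traces of the base line and the comb at infinity\<close>

locale plane_compactification = cube_compactification j
  for j :: "real \<times> real \<Rightarrow> 'i \<Rightarrow> real"
begin

definition end_line :: "('i \<Rightarrow> real) set" where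
  "end_line = (\<Inter>m. closure (j ` halfline m))"

definition end_comb :: "('i \<Rightarrow> real) set" where
  "end_comb = (\<Inter>m. closure (j ` (halfline m \<union> teeth {m..})))"

text \<open>Tips of all teeth are included, also those in the finite part; intersecting with subsets
  of \<open>end_comb\<close> leaves the tips at infinity.\<close>

definition tips :: "('i \<Rightarrow> real) set" where
  "tips = closure (j ` (range real \<times> {1}))"

lemma closure_image_Un: "closure (j ` (A \<union> B)) = closure (j ` A) \<union> closure (j ` B)"
  by (simp add: image_Un)

lemma end_line_subset_end_comb: "end_line \<subseteq> end_comb"
  unfolding end_line_def end_comb_def closure_image_Un by blast

text \<open>A point outside \<open>end_line\<close> misses the closure of some
  \<open>halfline m\<close>, so it must lie in the closure of the teeth from \<open>m\<close>
  on.\<close>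

lemma end_comb_subset: "end_comb \<subseteq> end_line \<union> closure (j ` teeth UNIV)"
proof -
  have "closure (j ` teeth {m..}) \<subseteq> closure (j ` teeth UNIV)" for m
    by (intro closure_mono image_mono) (auto simp: teeth_def)
  then show ?thesis unfolding end_line_def end_comb_def closure_image_Un by blast
qed

lemma end_comb_subset_remainder: "end_comb \<subseteq> remainder"
proof -
  have "halfline m \<union> teeth {m..} \<subseteq> {z. norm z \<ge> real m}" for m
  proof
    fix z assume "z \<in> halfline m \<union> teeth {m..}"
    then have "\<bar>fst z\<bar> \<ge> real m" by (auto simp: halfline_def teeth_def)
    then show "z \<in> {z. norm z \<ge> real m}" using norm_fst_le [of "fst z" "snd z"] by simp
  qed
  then show ?thesis
    unfolding end_comb_def remainder_def by (intro INF_mono') (intro closure_mono image_mono)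
qed

lemma closure_image_chain:
  assumes anti: "\<And>m n::nat. m \<le> n \<Longrightarrow> S n \<subseteq> S m"
    and X: "X \<in> range (\<lambda>m. closure (j ` S m))" and Y: "Y \<in> range (\<lambda>m. closure (j ` S m))"
  shows "X \<subseteq> Y \<or> Y \<subseteq> X"
proof -
  obtain m n where mn: "X = closure (j ` S m)" "Y = closure (j ` S n)" using X Y by blast
  have "S n \<subseteq> S m \<or> S m \<subseteq> S n" using anti nat_le_linear by blast
  then show ?thesis unfolding mn by (meson closure_mono image_mono)
qed

lemma connected_INT_closure_image:
  assumes "\<And>m::nat. connected (S m)" "\<And>m n. m \<le> n \<Longrightarrow> S n \<subseteq> S m"
  shows "connected (\<Inter>m. closure (j ` S m))"
proof (rule connected_chain_Inter)
  show "compact X \<and> connected X" if "X \<in> range (\<lambda>m. closure (j ` S m))" for X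
    using that assms(1) compact_closure_image continuous_on_subset [OF cont_j]
    by (auto intro!: connected_imp_connected_closure connected_continuous_image)
  show "X \<subseteq> Y \<or> Y \<subseteq> X"
    if "X \<in> range (\<lambda>m. closure (j ` S m))" "Y \<in> range (\<lambda>m. closure (j ` S m))" for X Y
    using closure_image_chain [OF assms(2) that] .
qed simp

lemma INT_closure_image_nonempty:
  assumes "\<And>m::nat. S m \<noteq> {}" "\<And>m n. m \<le> n \<Longrightarrow> S n \<subseteq> S m"
  shows "(\<Inter>m. closure (j ` S m)) \<noteq> {}"
proof (rule compact_chain_Inter_nonempty)
  show "compact X \<and> X \<noteq> {}" if "X \<in> range (\<lambda>m. closure (j ` S m))" for X
    using that assms(1) compact_closure_image by auto
  show "X \<subseteq> Y \<or> Y \<subseteq> X"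
    if "X \<in> range (\<lambda>m. closure (j ` S m))" "Y \<in> range (\<lambda>m. closure (j ` S m))" for X Y
    using closure_image_chain [OF assms(2) that] .
qed simp

lemma connected_end_line: "connected end_line"
  unfolding end_line_def
  by (rule connected_INT_closure_image) (auto simp: halfline_def intro!: connected_Times)

lemma end_line_nonempty: "end_line \<noteq> {}"
  unfolding end_line_def by (rule INT_closure_image_nonempty) (auto simp: halfline_def)

lemma connected_end_comb: "connected end_comb"
  unfolding end_comb_def
  by (rule connected_INT_closure_image [OF connected_comb]) (auto simp: halfline_def teeth_def)

text \<open>The height, clamped to \<open>[0,1]\<close>, is a coordinate; it is \<open>1\<close> on
  the tips and \<open>0\<close> on the base line.\<close>

lemma tips_disjoint_end_line: "tips \<inter> end_line = {}"
proof -
  have "continuous_on UNIV (\<lambda>z::real \<times> real. max 0 (min 1 (snd z)))"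
    by (intro continuous_intros)
  from coordinate [OF this] obtain i where i: "\<And>z. j z i = max 0 (min 1 (snd z))"
    by (auto simp del: split_paired_All)
  have "p i \<in> {1}" if "p \<in> tips" for p
    using that unfolding tips_def by (rule closure_image_coordinate) (auto simp: i)
  moreover have "p i \<in> {0}" if "p \<in> end_line" for p
  proof -
    have "p \<in> closure (j ` halfline 0)" using that by (auto simp: end_line_def)
    then show ?thesis by (rule closure_image_coordinate) (auto simp: i halfline_def)
  qed
  ultimately show ?thesis by fastforce
qed

text \<open>Sets of integers are closed in the line, so a Urysohn function of the first coordinate
  separates complementary families of teeth.\<close>

lemma closure_teeth_disjoint: "closure (j ` teeth A) \<inter> closure (j ` teeth (- A)) = {}"
proof -
  have "closedin (top_of_set UNIV) (real ` A)" "closedin (top_of_set UNIV) (real ` (- A))"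
    by (auto simp: closed_of_nat_image)
  moreover have "real ` A \<inter> real ` (- A) = {}" by auto
  ultimately obtain f :: "real \<Rightarrow> real" where f: "continuous_on UNIV f"
    "\<And>x. x \<in> UNIV \<Longrightarrow> f x \<in> closed_segment 0 1"
    "\<And>x. x \<in> real ` A \<Longrightarrow> f x = 0" "\<And>x. x \<in> real ` (- A) \<Longrightarrow> f x = 1"
    by (rule Urysohn_local [where a = 0 and b = 1]) blast
  have "continuous_on UNIV (\<lambda>z::real \<times> real. f (fst z))"
    by (rule continuous_on_compose2 [OF f(1)]) (auto intro!: continuous_intros)
  moreover have "f (fst z) \<in> {0..1}" for z :: "real \<times> real"
    using f(2) by (simp add: closed_segment_eq_real_ivl)
  ultimately obtain i where i: "\<And>z. j z i = f (fst z)" using coordinate by meson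
  have "p i \<in> {0}" if "p \<in> closure (j ` teeth A)" for p
    using that by (rule closure_image_coordinate) (auto simp: i teeth_def f(3))
  moreover have "p i \<in> {1}" if "p \<in> closure (j ` teeth (- A))" for p
    using that by (rule closure_image_coordinate) (use f(4) in \<open>auto simp: i teeth_def\<close>)
  ultimately show ?thesis by fastforce
qed

section \<open>A coordinate that is constant on each tooth\<close>

text \<open>The square root slows the oscillation down so that the values at the integers are dense
  in \<open>[0,1]\<close>. This is the function \<open>x\<close> of the overview before its
  extension to infinity.\<close>

definition wave :: "real \<times> real \<Rightarrow> real" where
  "wave z = (1 + sin (sqrt \<bar>fst z\<bar>)) / 2"

definition wave_index :: 'i where
  "wave_index = (SOME i. \<forall>z. j z i = wave z)"

lemma j_wave_index [simp]: "j z wave_index = wave z"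
proof -
  have "continuous_on UNIV wave" unfolding wave_def by (auto intro!: continuous_intros)
  moreover have "wave z \<in> {0..1}" for z
  proof -
    have "(1 + s) / 2 \<in> {0..1}" if "-1 \<le> s" "s \<le> 1" for s :: real using that by auto
    then show ?thesis by (simp only: wave_def sin_ge_minus_one sin_le_one)
  qed
  ultimately have "\<exists>i. \<forall>z. j z i = wave z" by (rule coordinate)
  then show ?thesis unfolding wave_index_def by (rule someI2_ex) blast
qed

text \<open>The set \<open>S m\<close> consists of tips from tooth \<open>m\<close> on where
  \<open>wave\<close> is within \<open>1 / Suc m\<close> of \<open>c\<close>. These sets are
  non-empty and decreasing, so by compactness their closures have a common point, where the value is
  exactly \<open>c\<close>.\<close>

lemma wave_onto:
  assumes c: "c \<in> {0..1}"
  shows "\<exists>p\<in>end_comb \<inter> tips. p wave_index = c"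
proof -
  define S where "S m = {(real k, 1::real) | k. k \<ge> m \<and> \<bar>wave (real k, 1) - c\<bar> < 1 / Suc m}" for m
  have "S m \<noteq> {}" for m
  proof -
    \<comment> \<open>Undoing the rescaling \<open>(1 + s) / 2\<close> in \<open>wave\<close> turns
      \<open>c\<close> into \<open>2 * c - 1\<close> and doubles the tolerance.\<close>
    have "\<bar>2 * c - 1\<bar> \<le> 1" "2 / real (Suc m) > 0" using c by auto
    then obtain k where "k \<ge> m" "\<bar>sin (sqrt (real k)) - (2 * c - 1)\<bar> < 2 / Suc m"
      by (rule sin_sqrt_dense)
    then have "k \<ge> m \<and> \<bar>wave (real k, 1) - c\<bar> < 1 / Suc m"
      by (simp add: wave_def abs_if field_simps split: if_splits)
    then show ?thesis by (auto simp: S_def)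
  qed
  moreover have "S n \<subseteq> S m" if "m \<le> n" for m n
  proof -
    have "1 / real (Suc n) \<le> 1 / real (Suc m)" using that by (intro divide_left_mono) auto
    then show ?thesis using that unfolding S_def by force
  qed
  ultimately have "(\<Inter>m. closure (j ` S m)) \<noteq> {}" by (rule INT_closure_image_nonempty)
  then obtain p where p: "\<And>m. p \<in> closure (j ` S m)" by auto
  have "S m \<subseteq> halfline m \<union> teeth {m..}" "S m \<subseteq> range real \<times> {1}" for m
    by (auto simp: S_def teeth_def)
  then have "p \<in> end_comb" "p \<in> tips"
    using p unfolding end_comb_def tips_def by (meson INT_I closure_mono image_mono subsetD)+
  moreover have "\<bar>p wave_index - c\<bar> \<le> 1 / real (Suc m)" for m
  proof -
    have "p wave_index \<in> cball c (1 / real (Suc m))"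
      by (rule closure_image_coordinate [OF p [of m]])
        (auto simp: S_def dist_real_def abs_minus_commute less_imp_le)
    then show ?thesis by (simp add: dist_real_def abs_minus_commute)
  qed
  then have "p wave_index = c"
  proof -
    have "\<not> \<bar>p wave_index - c\<bar> > 0"
      using \<open>\<And>m. \<bar>p wave_index - c\<bar> \<le> 1 / real (Suc m)\<close> reals_Archimedean
      by (metis inverse_eq_divide not_le)
    then show ?thesis by simp
  qed
  ultimately show ?thesis by blast
qed

section \<open>Minimal connected sets carrying all values\<close>

text \<open>The condition on the tips forces \<open>K\<close> to leave \<open>end_line\<close>.
  Asking for a whole interval of values makes it survive the removal of a single level, by
  compactness.\<close>

definition crossing :: "('i \<Rightarrow> real) set set" where
  "crossing = {K. closed K \<and> connected K \<and> end_line \<subseteq> K \<and> K \<subseteq> end_comb \<and>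
     (\<forall>c\<in>{0..1}. \<exists>p\<in>K \<inter> tips. p wave_index = c)}"

lemma closed_ends: "closed end_line" "closed end_comb" "closed tips"
  unfolding end_line_def end_comb_def tips_def by auto

lemma compact_subset_end_comb:
  assumes "closed K" "K \<subseteq> end_comb"
  shows "compact K"
proof -
  have "K \<subseteq> closure (j ` (halfline 0 \<union> teeth {0..}))" using assms(2) unfolding end_comb_def by blast
  then show ?thesis
    using compact_Int_closed [OF compact_closure_image assms(1)] by (metis inf.absorb2)
qed

text \<open>For intersections of chains, connectedness comes from
  \<open>connected_chain_Inter\<close>, and each value \<open>c\<close> is kept because the sets of
  tips with value \<open>c\<close> in the members form a chain of non-empty compact sets.\<close>

lemma minimal_crossing: "\<exists>K\<in>crossing. \<forall>X\<in>crossing. X \<subseteq> K \<longrightarrow> X = K"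
proof (rule Zorn_minimal_set)
  have "end_comb \<in> crossing"
    using closed_ends connected_end_comb end_line_subset_end_comb wave_onto by (auto simp: crossing_def)
  then show "crossing \<noteq> {}" by blast
  fix \<C> assume ne: "\<C> \<noteq> {}" and chain: "subset.chain crossing \<C>"
  then have C: "\<C> \<subseteq> crossing" "\<And>X Y. X \<in> \<C> \<Longrightarrow> Y \<in> \<C> \<Longrightarrow> X \<subseteq> Y \<or> Y \<subseteq> X"
    by (auto simp: subset_chain_def)
  have comp: "compact X \<and> connected X" if "X \<in> \<C>" for X
    using C(1) that compact_subset_end_comb by (auto simp: crossing_def)
  have "connected (\<Inter>\<C>)" by (rule connected_chain_Inter [OF ne comp C(2)])
  moreover have "\<exists>p\<in>\<Inter>\<C> \<inter> tips. p wave_index = c" if c: "c \<in> {0..1}" for c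
  proof -
    define fibre where "fibre = tips \<inter> {p. p wave_index \<in> {c}}"
    have "closed fibre" unfolding fibre_def by (intro closed_Int closed_ends closed_coordinate closed_singleton)
    have "\<Inter>((\<lambda>X. X \<inter> fibre) ` \<C>) \<noteq> {}"
    proof (rule compact_chain_Inter_nonempty)
      show "compact S \<and> S \<noteq> {}" if "S \<in> (\<lambda>X. X \<inter> fibre) ` \<C>" for S
      proof -
        obtain X where X: "X \<in> \<C>" "S = X \<inter> fibre" using \<open>S \<in> _\<close> by blast
        then have "X \<in> crossing" using C(1) by blast
        then show ?thesis
          using X comp \<open>closed fibre\<close> c by (auto simp: crossing_def fibre_def intro: compact_Int_closed)
      qed
      show "S \<subseteq> T \<or> T \<subseteq> S" if "S \<in> (\<lambda>X. X \<inter> fibre) ` \<C>" "T \<in> (\<lambda>X. X \<inter> fibre) ` \<C>" for S T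
        using that C(2) by (smt (verit, best) imageE inf_mono order_refl)
    qed (use ne in simp)
    then show ?thesis using ne by (auto simp: fibre_def)
  qed
  ultimately show "\<Inter>\<C> \<in> crossing"
  proof -
    assume conn: "connected (\<Inter>\<C>)" and onto: "\<And>c. c \<in> {0..1} \<Longrightarrow> \<exists>p\<in>\<Inter>\<C> \<inter> tips. p wave_index = c"
    obtain X where "X \<in> \<C>" using ne by blast
    then have "X \<subseteq> end_comb" using C(1) by (auto simp: crossing_def)
    then have "\<Inter>\<C> \<subseteq> end_comb" using \<open>X \<in> \<C>\<close> by blast
    moreover have "closed (\<Inter>\<C>)" "end_line \<subseteq> \<Inter>\<C>" using C(1) by (auto simp: crossing_def)
    ultimately show ?thesis using conn onto by (simp add: crossing_def)
  qed
qed

text \<open>The values on the remaining tips form a closed set containing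
  \<open>{0..1} - {c}\<close>; omitting \<open>c\<close> would disconnect the interval. A separation
  of the remaining set would yield one of \<open>K\<close>: the piece away from
  \<open>end_line\<close> contains points off the level \<open>c\<close>, and these can be cut out
  along whole teeth.\<close>

lemma remove_level_set_crossing:
  assumes K: "K \<in> crossing"
  shows "end_line \<union> closure (K - {p. p wave_index = c}) \<in> crossing"
    (is "?L \<in> _")
proof -
  have clK: "closed K" and conK: "connected K" and lineK: "end_line \<subseteq> K" and Kcomb: "K \<subseteq> end_comb"
    and onto: "\<And>a. a \<in> {0..1} \<Longrightarrow> \<exists>p\<in>K \<inter> tips. p wave_index = a"
    using K by (auto simp: crossing_def)
  have "closure (K - {p. p wave_index = c}) \<subseteq> K" by (intro closure_minimal clK) auto
  then have LK: "?L \<subseteq> K" using lineK by blast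
  have clL: "closed ?L" by (intro closed_Un closed_ends closed_closure)
  have levels: "K - {p. p wave_index = c} \<subseteq> ?L" by (rule le_supI2) (rule closure_subset)
  have "\<exists>p\<in>?L \<inter> tips. p wave_index = a" if a: "a \<in> {0..1}" for a
  proof -
    have "compact (?L \<inter> tips)"
      using LK Kcomb clL closed_ends by (intro compact_Int_closed compact_subset_end_comb) auto
    then have "compact ((\<lambda>p. p wave_index) ` (?L \<inter> tips))"
      by (intro compact_continuous_image continuous_on_subset [OF continuous_on_product_coordinates]) auto
    then have cl: "closed ((\<lambda>p. p wave_index) ` (?L \<inter> tips))" by (rule compact_imp_closed)
    have sub: "{0..1} - {c} \<subseteq> (\<lambda>p. p wave_index) ` (?L \<inter> tips)"
    proof
      fix b assume "b \<in> {0..1} - {c}"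
      then obtain p where "p \<in> K \<inter> tips" "p wave_index = b" "b \<noteq> c" using onto by blast
      then show "b \<in> (\<lambda>p. p wave_index) ` (?L \<inter> tips)" using levels by blast
    qed
    have "{0..1} \<subseteq> (\<lambda>p. p wave_index) ` (?L \<inter> tips)" (is "_ \<subseteq> ?C")
    proof (rule ccontr)
      assume "\<not> ?thesis"
      then have "c \<in> {0..1}" "c \<notin> ?C" using sub by blast+
      then have "{0..1} \<subseteq> ?C \<union> {c}" "?C \<inter> {c} \<inter> {0..1} = {}" "{c} \<inter> {0..1} \<noteq> {}" using sub by blast+
      moreover have "{0..1} - {c} \<noteq> {}"
        by (metis Diff_eq_empty_iff atLeastAtMost_iff insertE order_refl singletonD subsetD zero_le_one zero_neq_one)
      then have "?C \<inter> {0..1} \<noteq> {}" using sub by blast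
      ultimately show False
        using connected_closedD [OF connected_Icc, of ?C "{c}"] cl by blast
    qed
    then show ?thesis using a by (auto simp: image_iff)
  qed
  moreover have "connected ?L"
    unfolding connected_closed_set [OF clL]
  proof (intro notI, elim exE conjE)
    fix A B assume AB: "closed A" "closed B" "A \<noteq> {}" "B \<noteq> {}" "A \<union> B = ?L" "A \<inter> B = {}"
    have "end_line \<subseteq> A \<or> end_line \<subseteq> B"
      using connected_closedD [OF connected_end_line, of A B] AB by blast
    then obtain P Q where PQ: "closed P" "closed Q" "Q \<noteq> {}" "P \<union> Q = ?L" "P \<inter> Q = {}" "end_line \<subseteq> P"
      using AB by (metis Int_commute Un_commute)
    have "Q \<subseteq> closure (K - {p. p wave_index = c})" using PQ by blast
    \<comment> \<open>Since \<open>- P\<close> is open, meeting the closure means meeting the set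
      itself, which yields a point \<open>q\<close> off the level \<open>c\<close>.\<close>
    then have "- P \<inter> closure (K - {p. p wave_index = c}) \<noteq> {}" using PQ by blast
    then have "- P \<inter> (K - {p. p wave_index = c}) \<noteq> {}"
      using open_Int_closure_eq_empty [of "- P"] PQ(1) by (simp add: open_Compl)
    then obtain q where q: "q \<in> K" "q wave_index \<noteq> c" "q \<notin> P" by blast
    then have "q \<in> Q" using levels PQ(4) by blast
    \<comment> \<open>The teeth on which \<^term>\<open>wave\<close> is far from \<^term>\<open>c\<close> cut out of \<^term>\<open>Q\<close> a set that is
      clopen in \<^term>\<open>K\<close>, because away from the level \<^term>\<open>c\<close> nothing has been removed from \<^term>\<open>K\<close>.\<close>
    define d where "d = \<bar>q wave_index - c\<bar> / 2"
    have d: "0 < d" "d < \<bar>q wave_index - c\<bar>" using q(2) by (auto simp: d_def)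
    define N where "N = {k. \<bar>wave (real k, 0) - c\<bar> > d}"
    let ?T = "closure (j ` teeth N)" and ?T' = "closure (j ` teeth (- N))"
    have "teeth UNIV = teeth N \<union> teeth (- N)" by (auto simp: teeth_def)
    then have "closure (j ` teeth UNIV) = ?T \<union> ?T'" by (simp only: closure_image_Un)
    then have KT: "K \<subseteq> end_line \<union> (?T \<union> ?T')"
      using Kcomb end_comb_subset by blast
    have far: "\<bar>p wave_index - c\<bar> \<ge> d" if "p \<in> ?T" for p
    proof -
      have "closed {v::real. \<bar>v - c\<bar> \<ge> d}" by (intro closed_Collect_le continuous_intros)
      then have "p wave_index \<in> {v. \<bar>v - c\<bar> \<ge> d}"
        by (rule closure_image_coordinate [OF that]) (auto simp: teeth_def N_def wave_def)
      then show ?thesis by simp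
    qed
    have near: "\<bar>p wave_index - c\<bar> \<le> d" if "p \<in> ?T'" for p
    proof -
      have "closed {v::real. \<bar>v - c\<bar> \<le> d}" by (intro closed_Collect_le continuous_intros)
      then have "p wave_index \<in> {v. \<bar>v - c\<bar> \<le> d}"
        by (rule closure_image_coordinate [OF that]) (auto simp: teeth_def N_def wave_def)
      then show ?thesis by simp
    qed
    \<comment> \<open>Being outside \<open>P\<close>, \<open>q\<close> is not in
      \<open>end_line\<close>, and its value is too far from \<open>c\<close> for the teeth outside
      \<open>N\<close>.\<close>
    have "q \<in> ?T" using q(1,3) KT PQ(6) near [of q] d(2) by (meson UnE leD subsetD)
    \<comment> \<open>On \<open>?T\<close> the value stays at least \<open>d\<close> away from
      \<open>c\<close>, so none of these points was removed.\<close>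
    have "K \<inter> ?T \<subseteq> P \<union> Q" using levels far d(1) PQ(4) by fastforce
    then have "K \<subseteq> (Q \<inter> ?T) \<union> (P \<union> (K \<inter> ?T'))" using KT PQ(6) by blast
    moreover have "(Q \<inter> ?T) \<inter> (P \<union> (K \<inter> ?T')) = {}"
      using closure_teeth_disjoint [of N] PQ(5) by blast
    moreover have "closed (Q \<inter> ?T)" "closed (P \<union> (K \<inter> ?T'))"
      by (intro closed_Int closed_Un PQ clK closed_closure)+
    moreover have "(Q \<inter> ?T) \<inter> K \<noteq> {}" using \<open>q \<in> Q\<close> \<open>q \<in> ?T\<close> q(1) by blast
    moreover have "(P \<union> (K \<inter> ?T')) \<inter> K \<noteq> {}" using end_line_nonempty PQ(6) lineK by blast
    ultimately show False using conK unfolding connected_closed by blast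
  qed
  ultimately show ?thesis using clL LK Kcomb by (auto simp: crossing_def)
qed

lemma nowhere_locally_constant_coordinate:
  "\<exists>K W i. closed K \<and> connected K \<and> K \<subseteq> remainder \<and> openin (top_of_set K) W \<and> W \<noteq> {} \<and>
    (\<forall>G c. openin (top_of_set K) G \<and> G \<subseteq> W \<and> G \<noteq> {} \<longrightarrow> (\<exists>p\<in>G. p i \<noteq> c))"
proof -
  obtain K where K: "K \<in> crossing" and min: "\<And>X. X \<in> crossing \<Longrightarrow> X \<subseteq> K \<Longrightarrow> X = K"
    using minimal_crossing by blast
  have clK: "closed K" and conK: "connected K" and lineK: "end_line \<subseteq> K" and Kcomb: "K \<subseteq> end_comb"
    and onto: "\<And>a. a \<in> {0..1} \<Longrightarrow> \<exists>p\<in>K \<inter> tips. p wave_index = a"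
    using K by (auto simp: crossing_def)
  show ?thesis
  proof (rule exI [of _ K], rule exI [of _ "K - end_line"], rule exI [of _ wave_index], intro conjI allI impI)
    show "K \<subseteq> remainder" using Kcomb end_comb_subset_remainder by blast
    show "openin (top_of_set K) (K - end_line)"
      using closed_ends(1) by (simp add: Diff_eq openin_open_Int open_Compl)
    show "K - end_line \<noteq> {}" using onto [of 0] tips_disjoint_end_line by fastforce
    fix G c assume "openin (top_of_set K) G \<and> G \<subseteq> K - end_line \<and> G \<noteq> {}"
    then have G: "openin (top_of_set K) G" "G \<subseteq> K - end_line" "G \<noteq> {}" by auto
    show "\<exists>p\<in>G. p wave_index \<noteq> c"
    proof (rule ccontr)
      assume "\<not> ?thesis"
      then have const: "\<And>p. p \<in> G \<Longrightarrow> p wave_index = c" by blast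
      obtain T where T: "open T" "G = K \<inter> T" using G(1) by (auto simp: openin_open)
      \<comment> \<open>An open set that misses a set misses its closure, so removing the level
        \<open>c\<close> would remove all of \<open>G\<close>, against minimality.\<close>
      have "T \<inter> (K - {p. p wave_index = c}) = {}" using T(2) const by blast
      then have "T \<inter> closure (K - {p. p wave_index = c}) = {}"
        using open_Int_closure_eq_empty [OF T(1)] by blast
      then have "G \<inter> (end_line \<union> closure (K - {p. p wave_index = c})) = {}"
        using G(2) T(2) by blast
      moreover have "closure (K - {p. p wave_index = c}) \<subseteq> K" by (intro closure_minimal clK) auto
      then have "end_line \<union> closure (K - {p. p wave_index = c}) = K"
        using lineK by (intro min remove_level_set_crossing K) auto
      ultimately show False using G(2,3) by blast
    qed
  qed (fact clK conK)+
qed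

end

theorem mainTheorem2:
  shows "\<exists>K :: ((real \<Rightarrow> real) \<Rightarrow> real) topology.
    compact_F_space K \<and> connected_space K \<and>
    (\<exists>D. maximal_d_independent (continuous_functions K) D \<and>
         \<not> d_basis (continuous_functions K) D)"
proof -
  obtain j :: "real \<times> real \<Rightarrow> (real \<Rightarrow> real) \<Rightarrow> real" where "cube_compactification j"
    by (rule exists_cube_compactification_plane)
  then interpret plane_compactification j by (simp add: plane_compactification_def)
  obtain K W i where K: "closed K" "connected K" "K \<subseteq> remainder"
    and W: "openin (top_of_set K) W" "W \<noteq> {}"
      "\<forall>G c. openin (top_of_set K) G \<and> G \<subseteq> W \<and> G \<noteq> {} \<longrightarrow> (\<exists>p\<in>G. p i \<noteq> c)"
    using nowhere_locally_constant_coordinate by blast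
  have F: "compact_F_space (top_of_set K)" using K by (intro compact_F_space_remainder)
  have conn: "connected_space (top_of_set K)" using K(2) by (simp add: connected_space_subtopology)
  have "continuous_map (top_of_set K) euclideanreal (\<lambda>p. p i)"
    by (simp add: continuous_on_subset [OF continuous_on_product_coordinates])
  then have "\<not> d_basis (continuous_functions (top_of_set K)) {0, indicat_real (topspace (top_of_set K))}"
    using F W unfolding compact_F_space_def by (intro not_d_basis_zero_one) auto
  with F conn maximal_d_independent_zero_one show ?thesis by blast
qed

end
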